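(* If $G$ is a simple oriented hypergraph with vertices $v_1,\dots,v_n$, then the $(i,j)$-entry of $L_G$ is $\ell_{ij}=\widetilde{w}(v_i,v_j;1)-2w^+(v_i,v_j;1)$.
   Context: An oriented hypergraph $G=(V,E,\mathcal{I},\sigma)$ consists of disjoint finite sets $V$, $E$, an incidence function $\iota:V\times E\to\mathbb{Z}_{\ge0}$, incidences $(v,e,k)$ with $1\le k\le\iota(v,e)$, and $\sigma:\mathcal{I}\to\{+1,-1\}$. Simple means $\iota(v,e)\le1$; write $(v,e)$ for $(v,e,1)$. For simple $G$: $sgn_e(v,w)=-\sigma(v,e)\sigma(w,e)$ if $(v,e),(w,e)$ are distinct incidences and $0$ otherwise; $A_G=[a_{ij}]$, $a_{ij}=\sum_e sgn_e(v_i,v_j)$; $D_G=\mathrm{diag}(\deg v_1,\dots,\deg v_n)$ with $\deg v$ the number of incidences containing $v$; $L_G=D_G-A_G$. A walk is a sequence $W=a_0,i_1,a_1,\dots,i_n,a_n$ where $a_0,\dots,a_n$ alternate between vertices and edges, each $i_h$ is an incidence containing $a_{h-1}$ and $a_h$, and $i_{2h-1}\ne i_{2h}$ for all $h$ with $2h\le n$; its length is $n/2$ and its sign is $(-1)^{\lfloor n/2\rfloor}\prod_{h=1}^n\sigma(i_h)$. A weak walk is defined the same way without the condition $i_{2h-1}\ne i_{2h}$. $w^+(a,b;k)$ is the number of positive walks of length $k$ from $a$ to $b$, and $\widetilde{w}(a,b;k)$ is the number of weak walks of length $k$ from $a$ to $b$. *)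

theory Defs
  imports Complex_Main "Jordan_Normal_Form.Matrix"
begin

text \<open>
  Vertices and edges are elements of one type, kept apart by the disjointness assumption
  below; this lets a walk start and end at a vertex or at an edge.
  Only the values of \<open>iota\<close> on \<open>verts G \<times> edges G\<close>, and of \<open>sigma\<close> on incidences, are ever used.
\<close>

record 'a ohgraph =
  verts :: "'a set"
  edges :: "'a set"
  iota  :: "'a \<Rightarrow> 'a \<Rightarrow> nat"
  sigma :: "'a \<times> 'a \<times> nat \<Rightarrow> int"

definition incidences :: "'a ohgraph \<Rightarrow> ('a \<times> 'a \<times> nat) set" where
  "incidences G = {(v, e, k). v \<in> verts G \<and> e \<in> edges G \<and> 1 \<le> k \<and> k \<le> iota G v e}"

definition oriented_hypergraph :: "'a ohgraph \<Rightarrow> bool" where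
  "oriented_hypergraph G \<longleftrightarrow>
     finite (verts G) \<and> finite (edges G) \<and> verts G \<inter> edges G = {} \<and>
     sigma G ` incidences G \<subseteq> {1, -1}"

definition simple_ohg :: "'a ohgraph \<Rightarrow> bool" where
  "simple_ohg G \<longleftrightarrow> (\<forall>v\<in>verts G. \<forall>e\<in>edges G. iota G v e \<le> 1)"

fun contains :: "'a \<times> 'a \<times> nat \<Rightarrow> 'a \<Rightarrow> bool" where
  "contains (v, e, k) a \<longleftrightarrow> a = v \<or> a = e"

definition deg :: "'a ohgraph \<Rightarrow> 'a \<Rightarrow> nat" where
  "deg G v = card {i \<in> incidences G. contains i v}"

text \<open>The next notion is meant for simple \<open>G\<close>, where \<open>(v, e)\<close> abbreviates \<open>(v, e, 1)\<close>.\<close>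

definition edge_sgn :: "'a ohgraph \<Rightarrow> 'a \<Rightarrow> 'a \<Rightarrow> 'a \<Rightarrow> int" where
  "edge_sgn G e v w =
     (if (v, e, 1) \<in> incidences G \<and> (w, e, 1) \<in> incidences G \<and> (v, e, 1::nat) \<noteq> (w, e, 1)
      then - (sigma G (v, e, 1) * sigma G (w, e, 1)) else 0)"

text \<open>
  The matrices depend on an enumeration \<open>vs\<close> of the vertices. Since matrices are indexed
  from 0, the vertex \<open>v\<^sub>i\<close> of the 1-based convention is \<open>vs ! (i - 1)\<close>.
\<close>

definition adj_mat :: "'a ohgraph \<Rightarrow> 'a list \<Rightarrow> int mat" where
  "adj_mat G vs =
     mat (length vs) (length vs) (\<lambda>(i, j). \<Sum>e\<in>edges G. edge_sgn G e (vs ! i) (vs ! j))"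

definition deg_mat :: "'a ohgraph \<Rightarrow> 'a list \<Rightarrow> int mat" where
  "deg_mat G vs = mat_diag (length vs) (\<lambda>i. int (deg G (vs ! i)))"

definition laplacian :: "'a ohgraph \<Rightarrow> 'a list \<Rightarrow> int mat" where
  "laplacian G vs = deg_mat G vs - adj_mat G vs"

text \<open>
  The sequence \<open>a\<^sub>0, i\<^sub>1, a\<^sub>1, \<dots>, i\<^sub>n, a\<^sub>n\<close> is the pair of lists
  \<open>([a\<^sub>0, \<dots>, a\<^sub>n], [i\<^sub>1, \<dots>, i\<^sub>n])\<close>; so \<open>i\<^sub>h\<close> is element \<open>h - 1\<close> of the second list.
\<close>

type_synonym 'a wseq = "'a list \<times> ('a \<times> 'a \<times> nat) list"

definition weak_walk :: "'a ohgraph \<Rightarrow> 'a wseq \<Rightarrow> bool" where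
  "weak_walk G = (\<lambda>(as, is).
     length as = length is + 1 \<and>
     set as \<subseteq> verts G \<union> edges G \<and>
     (\<forall>h<length is. as ! h \<in> verts G \<and> as ! (h + 1) \<in> edges G \<or>
                    as ! h \<in> edges G \<and> as ! (h + 1) \<in> verts G) \<and>
     (\<forall>h\<in>{1..length is}. is ! (h - 1) \<in> incidences G \<and>
        contains (is ! (h - 1)) (as ! (h - 1)) \<and> contains (is ! (h - 1)) (as ! h)))"

definition walk :: "'a ohgraph \<Rightarrow> 'a wseq \<Rightarrow> bool" where
  "walk G W \<longleftrightarrow> weak_walk G W \<and>
     (\<forall>h. 1 \<le> h \<and> 2 * h \<le> length (snd W) \<longrightarrow> snd W ! (2 * h - 2) \<noteq> snd W ! (2 * h - 1))"

definition walk_length :: "'a wseq \<Rightarrow> rat" where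
  "walk_length W = of_nat (length (snd W)) / 2"

definition walk_sign :: "'a ohgraph \<Rightarrow> 'a wseq \<Rightarrow> int" where
  "walk_sign G W = (-1) ^ (length (snd W) div 2) * prod_list (map (sigma G) (snd W))"

definition walk_from_to :: "'a \<Rightarrow> 'a \<Rightarrow> 'a wseq \<Rightarrow> bool" where
  "walk_from_to a b W \<longleftrightarrow> hd (fst W) = a \<and> last (fst W) = b"

definition num_pos_walks :: "'a ohgraph \<Rightarrow> 'a \<Rightarrow> 'a \<Rightarrow> rat \<Rightarrow> nat" where
  "num_pos_walks G a b k =
     card {W. walk G W \<and> walk_from_to a b W \<and> walk_length W = k \<and> walk_sign G W = 1}"

definition num_weak_walks :: "'a ohgraph \<Rightarrow> 'a \<Rightarrow> 'a \<Rightarrow> rat \<Rightarrow> nat" where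
  "num_weak_walks G a b k =
     card {W. weak_walk G W \<and> walk_from_to a b W \<and> walk_length W = k}"

end

(* A weak walk of length 1 from v to w is determined by its middle edge e, which may be any edge
   incident to both. If v = w, these walks are counted by deg v, and none of them is a walk.
   If v and w are distinct, all of them are walks, with sign -sigma(v,e) sigma(w,e); the claim is
   then the sum over all such e of sigma(v,e) sigma(w,e) = 1 - 2 [sigma(v,e) sigma(w,e) = -1]. *)
theory Submission imports Defs
begin

text \<open>The case \<open>v = w\<close> is allowed and gives the edges incident to
  \<open>v\<close>, so diagonal and off-diagonal entries are both counted through this set.\<close>

definition common_edges :: "'a ohgraph \<Rightarrow> 'a \<Rightarrow> 'a \<Rightarrow> 'a set" where
  "common_edges G v w = {e. (v, e, 1) \<in> incidences G \<and> (w, e, 1) \<in> incidences G}"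

definition edge_walk :: "'a \<Rightarrow> 'a \<Rightarrow> 'a \<Rightarrow> 'a wseq" where
  "edge_walk v w e = ([v, e, w], [(v, e, 1), (w, e, 1)])"

lemma inj_edge_walk: "inj_on (edge_walk v w) S"
  by (auto simp: inj_on_def edge_walk_def)

lemma oriented_hypergraphD:
  assumes "oriented_hypergraph G"
  shows "finite (edges G)" "\<And>x. x \<in> verts G \<Longrightarrow> x \<notin> edges G"
    "\<And>x. x \<in> incidences G \<Longrightarrow> sigma G x = 1 \<or> sigma G x = -1"
  using assms by (auto simp: oriented_hypergraph_def)

lemma incidences_simple:
  assumes "simple_ohg G" and "(v, e, k) \<in> incidences G"
  shows "k = 1" "v \<in> verts G" "e \<in> edges G"
  using assms unfolding incidences_def simple_ohg_def by fastforce+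

text \<open>The predicate \<open>contains\<close> does not tell the vertex of an incidence from its
  edge. Disjointness of \<open>verts G\<close> and \<open>edges G\<close> settles which is which,
  and simplicity leaves only multiplicity index 1.\<close>

lemma incidence_containing:
  assumes "oriented_hypergraph G" "simple_ohg G" "v \<in> verts G" "e \<in> edges G"
    and "x \<in> incidences G" "contains x v" "contains x e"
  shows "x = (v, e, 1)"
proof -
  obtain a b k where x: "x = (a, b, k)" by (cases x)
  with assms incidences_simple[OF assms(2), of a b k] oriented_hypergraphD(2)[OF assms(1)]
  show ?thesis by auto
qed

lemma weak_walk_two_steps:
  "weak_walk G ([a, b, c], [x, y]) \<longleftrightarrow>
     {a, b, c} \<subseteq> verts G \<union> edges G \<and>
     (a \<in> verts G \<and> b \<in> edges G \<or> a \<in> edges G \<and> b \<in> verts G) \<and>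
     (b \<in> verts G \<and> c \<in> edges G \<or> b \<in> edges G \<and> c \<in> verts G) \<and>
     x \<in> incidences G \<and> contains x a \<and> contains x b \<and>
     y \<in> incidences G \<and> contains y b \<and> contains y c"
proof -
  have "{1..Suc (Suc 0)} = {1, Suc (Suc 0)}" by auto
  then show ?thesis
    by (auto simp: weak_walk_def All_less_Suc)
qed

text \<open>Length is half the number of incidences, so length 1 means two incidences and three
  entries. The ends are vertices, hence by alternation the middle entry is an edge, and it
  determines both incidences by \<open>incidence_containing\<close>.\<close>

lemma weak_walks_length_one:
  assumes G: "oriented_hypergraph G" "simple_ohg G" and vw: "v \<in> verts G" "w \<in> verts G"
  shows "{W. weak_walk G W \<and> walk_from_to v w W \<and> walk_length W = 1}
       = edge_walk v w ` common_edges G v w"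
proof (intro equalityI subsetI)
  fix W assume "W \<in> {W. weak_walk G W \<and> walk_from_to v w W \<and> walk_length W = 1}"
  then have W: "weak_walk G W" "walk_from_to v w W" "walk_length W = 1" by auto
  have l2: "length (snd W) = 2"
    using W(3) by (simp add: walk_length_def)
  moreover have "length (fst W) = 3"
    using W(1) l2 by (auto simp: weak_walk_def split: prod.splits)
  ultimately obtain a b c x y where Weq: "W = ([a, b, c], [x, y])"
    by (cases W) (auto simp: length_Suc_conv numeral_2_eq_2 numeral_3_eq_3)
  have ac: "a = v" "c = w"
    using W(2) by (auto simp: Weq walk_from_to_def)
  have b: "b \<in> edges G"
    using W(1) vw oriented_hypergraphD(2)[OF G(1)] by (auto simp: Weq ac weak_walk_two_steps)
  have xy: "x \<in> incidences G" "y \<in> incidences G" "x = (v, b, 1)" "y = (w, b, 1)"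
    using W(1) incidence_containing[OF G _ b] vw by (auto simp: Weq ac weak_walk_two_steps)
  then show "W \<in> edge_walk v w ` common_edges G v w"
    by (auto simp: Weq ac edge_walk_def common_edges_def)
next
  fix W assume "W \<in> edge_walk v w ` common_edges G v w"
  then obtain e where e: "(v, e, 1) \<in> incidences G" "(w, e, 1) \<in> incidences G"
    and W: "W = ([v, e, w], [(v, e, 1), (w, e, 1)])"
    by (auto simp: common_edges_def edge_walk_def)
  have "e \<in> edges G" using incidences_simple[OF G(2) e(1)] by simp
  with e vw show "W \<in> {W. weak_walk G W \<and> walk_from_to v w W \<and> walk_length W = 1}"
    by (simp add: W weak_walk_two_steps walk_from_to_def walk_length_def)
qed

lemma num_weak_walks_one:
  assumes "oriented_hypergraph G" "simple_ohg G" "v \<in> verts G" "w \<in> verts G"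
  shows "num_weak_walks G v w 1 = card (common_edges G v w)"
  unfolding num_weak_walks_def weak_walks_length_one[OF assms]
  by (rule card_image[OF inj_edge_walk])

text \<open>The two incidences \<open>(v, e, 1)\<close> and \<open>(w, e, 1)\<close> form the only
  pair that has to differ, and they share their edge.\<close>

lemma walk_edge_walk:
  "walk G (edge_walk v w e) \<longleftrightarrow> weak_walk G (edge_walk v w e) \<and> v \<noteq> w"
proof -
  have "(\<forall>h. 1 \<le> h \<and> 2 * h \<le> 2 \<longrightarrow> P h) \<longleftrightarrow> P 1" for P :: "nat \<Rightarrow> bool"
  proof
    show "\<forall>h. 1 \<le> h \<and> 2 * h \<le> 2 \<longrightarrow> P h" if "P 1"
    proof (intro allI impI)
      fix h :: nat assume "1 \<le> h \<and> 2 * h \<le> 2"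
      then have "h = 1" by linarith
      with that show "P h" by simp
    qed
  qed simp
  \<comment> \<open>The instance is spelled out with \<open>edge_walk\<close> still folded, so that
    it matches the quantified condition of \<open>walk_def\<close> once the length is rewritten to
    2.\<close>
  note this[of "\<lambda>h. snd (edge_walk v w e) ! (2 * h - 2) \<noteq> snd (edge_walk v w e) ! (2 * h - 1)"]
  moreover have "length (snd (edge_walk v w e)) = 2"
    by (simp add: edge_walk_def)
  ultimately show ?thesis
    by (simp only: walk_def) (simp add: edge_walk_def)
qed

text \<open>Two incidences contribute a factor \<open>(-1) ^ 1\<close> to the sign, so a positive
  walk needs product -1. The conjunct \<open>v \<noteq> w\<close> sits inside the set to make the
  count 0 on the diagonal.\<close>

lemma num_pos_walks_one:
  assumes "oriented_hypergraph G" "simple_ohg G" "v \<in> verts G" "w \<in> verts G"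
  shows "num_pos_walks G v w 1 =
    card {e \<in> common_edges G v w. v \<noteq> w \<and> sigma G (v, e, 1) * sigma G (w, e, 1) = -1}"
proof -
  have "{W. walk G W \<and> walk_from_to v w W \<and> walk_length W = 1 \<and> walk_sign G W = 1}
      = {W \<in> {W. weak_walk G W \<and> walk_from_to v w W \<and> walk_length W = 1}.
          walk G W \<and> walk_sign G W = 1}"
    by (auto simp: walk_def)
  also have "\<dots> = {W \<in> edge_walk v w ` common_edges G v w. walk G W \<and> walk_sign G W = 1}"
    by (simp only: weak_walks_length_one[OF assms])
  also have "\<dots> = edge_walk v w `
      {e \<in> common_edges G v w. v \<noteq> w \<and> sigma G (v, e, 1) * sigma G (w, e, 1) = -1}"
  proof -
    have "weak_walk G (edge_walk v w e)" if "e \<in> common_edges G v w" for e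
      using weak_walks_length_one[OF assms] that by blast
    moreover have "walk_sign G (edge_walk v w e) = 1 \<longleftrightarrow>
        sigma G (v, e, 1) * sigma G (w, e, 1) = -1" for e
      by (auto simp: walk_sign_def edge_walk_def)
    ultimately show ?thesis by (auto simp: walk_edge_walk)
  qed
  finally show ?thesis
    unfolding num_pos_walks_def by (simp add: card_image[OF inj_edge_walk])
qed

text \<open>An incidence could contain \<open>v\<close> only as its vertex, since a vertex is never
  an edge; by simplicity it is then fixed by its edge.\<close>

lemma deg_eq_card_common_edges:
  assumes "oriented_hypergraph G" "simple_ohg G" "v \<in> verts G"
  shows "deg G v = card (common_edges G v v)"
proof -
  have "{i \<in> incidences G. contains i v} = (\<lambda>e. (v, e, 1)) ` common_edges G v v"
  proof (intro equalityI subsetI)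
    fix x assume x: "x \<in> {i \<in> incidences G. contains i v}"
    obtain a e k where xe: "x = (a, e, k)" by (cases x)
    have "k = 1" "e \<in> edges G"
      using x incidences_simple[OF assms(2), of a e k] by (simp_all add: xe)
    moreover have "a = v"
      using x oriented_hypergraphD(2)[OF assms(1,3)] \<open>e \<in> edges G\<close> by (auto simp: xe)
    ultimately show "x \<in> (\<lambda>e. (v, e, 1)) ` common_edges G v v"
      using x by (simp add: xe common_edges_def)
  qed (auto simp: common_edges_def)
  then show ?thesis
    unfolding deg_def by (simp add: card_image inj_on_def)
qed

text \<open>Edges outside \<open>common_edges G v w\<close> contribute 0. On the others the product
  \<open>p\<close> of the two signs is 1 or -1, and
  \<open>- p = 2 * of_bool (p = -1) - 1\<close>.\<close>

lemma sum_edge_sgn: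
  assumes "oriented_hypergraph G" "simple_ohg G" "v \<noteq> w"
  shows "(\<Sum>e\<in>edges G. edge_sgn G e v w) =
    2 * int (card {e \<in> common_edges G v w. sigma G (v, e, 1) * sigma G (w, e, 1) = -1})
    - int (card (common_edges G v w))"
proof -
  let ?C = "common_edges G v w"
  let ?s = "\<lambda>e. sigma G (v, e, 1) * sigma G (w, e, 1)"
  have sub: "?C \<subseteq> edges G"
    by (auto simp: common_edges_def dest: incidences_simple(3)[OF assms(2)])
  have fin: "finite (edges G)" by (rule oriented_hypergraphD(1)[OF assms(1)])
  have finC: "finite ?C" by (rule finite_subset[OF sub fin])
  have "(\<Sum>e\<in>edges G. edge_sgn G e v w) = (\<Sum>e\<in>?C. edge_sgn G e v w)"
    by (rule sum.mono_neutral_right[OF fin sub]) (auto simp: edge_sgn_def common_edges_def)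
  also have "\<dots> = (\<Sum>e\<in>?C. 2 * of_bool (?s e = -1) - 1)"
  proof (rule sum.cong[OF refl])
    fix e assume "e \<in> ?C"
    then have e: "(v, e, 1) \<in> incidences G" "(w, e, 1) \<in> incidences G"
      by (auto simp: common_edges_def)
    show "edge_sgn G e v w = 2 * of_bool (?s e = -1) - 1"
      using e assms(3) oriented_hypergraphD(3)[OF assms(1) e(1)]
        oriented_hypergraphD(3)[OF assms(1) e(2)]
      by (auto simp: edge_sgn_def)
  qed
  also have "\<dots> = 2 * (\<Sum>e\<in>?C. of_bool (?s e = -1)) - int (card ?C)"
    by (simp add: sum_subtractf sum_distrib_left)
  also have "(\<Sum>e\<in>?C. of_bool (?s e = -1)) = int (card {e \<in> ?C. ?s e = -1})"
    using finC by (simp add: Int_def)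
  finally show ?thesis .
qed

theorem theorem5p6:
  fixes G :: "'a ohgraph" and vs :: "'a list" and i j :: nat
  assumes "oriented_hypergraph G" and "simple_ohg G"
    and "distinct vs" and "set vs = verts G"
    and "i < length vs" and "j < length vs"
  shows "laplacian G vs $$ (i, j) =
           int (num_weak_walks G (vs ! i) (vs ! j) 1) - 2 * int (num_pos_walks G (vs ! i) (vs ! j) 1)"
proof -
  have v: "vs ! i \<in> verts G" "vs ! j \<in> verts G"
    using nth_mem[OF assms(5)] nth_mem[OF assms(6)] by (simp_all only: assms(4))
  note counts = num_weak_walks_one[OF assms(1,2) v] num_pos_walks_one[OF assms(1,2) v]
  have L: "laplacian G vs $$ (i, j) = (if i = j then int (deg G (vs ! i)) else 0)
      - (\<Sum>e\<in>edges G. edge_sgn G e (vs ! i) (vs ! j))"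
    using assms(5,6) by (simp add: laplacian_def deg_mat_def adj_mat_def mat_diag_def)
  show ?thesis
  proof (cases "i = j")
    case True
    \<comment> \<open>Since \<open>edge_sgn\<close> asks for distinct incidences, the adjacency
      matrix has zero diagonal and only the degree remains.\<close>
    have "(\<Sum>e\<in>edges G. edge_sgn G e (vs ! i) (vs ! i)) = 0"
      by (simp add: edge_sgn_def)
    then show ?thesis
      unfolding L counts
      by (simp add: True[symmetric] deg_eq_card_common_edges[OF assms(1,2) v(1)])
  next
    case False
    then have ne: "vs ! i \<noteq> vs ! j"
      by (simp add: nth_eq_iff_index_eq[OF assms(3,5,6)])
    show ?thesis
      unfolding L counts sum_edge_sgn[OF assms(1,2) ne] by (simp add: False ne)
  qed
qed

end
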